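(* For every $n \geq 1$, the mixed page number of the complete bipartite graph $K_{n,n}$ is at least $\lceil \frac{n}{3} \rceil$.
   Context: Given a total vertex order $\prec$, two edges $(a_1,b_1)$, $(a_2,b_2)$ with four distinct endpoints and $a_1\prec b_1$, $a_2 \prec b_2$, $a_1 \prec a_2$ are said to cross if $a_1 \prec a_2 \prec b_1 \prec b_2$, and to nest if $a_1 \prec a_2 \prec b_2 \prec b_1$. A stack is a set of edges no two of which cross; a queue is a set of edges no two of which nest. The mixed page number of a graph $G$ is the minimum value of $s+q$ such that there is a total order of the vertices of $G$ (arbitrary, not necessarily separating the parts) and a partition of its edges into $s$ stacks and $q$ queues with respect to that order. *)

theory Defs
  imports Graph_Theory.Kuratowski "HOL-Library.Disjoint_Sets"
begin

text \<open>
  Graphs are those of Graph_Theory, where an undirected edge is a pair of opposite arcs.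
  A pair of opposite arcs must be assigned to a single page, so pages consist of undirected edges.
\<close>

definition uedges :: "('a, 'b) pre_digraph \<Rightarrow> 'a set set" where
  "uedges G = {{u, v} |u v. (u, v) \<in> arcs_ends G}"

text \<open>
  Below, \<open>r\<close> is the strict vertex order. For irreflexive and transitive \<open>r\<close> the chains force the
  four endpoints to be distinct, as well as \<open>a\<^sub>1 \<prec> b\<^sub>1\<close> and \<open>a\<^sub>2 \<prec> b\<^sub>2\<close>. The two predicates
  name the edge with the smaller first endpoint first; stacks and queues range over both orders
  of each pair of edges.
\<close>

definition crosses :: "'a rel \<Rightarrow> 'a set \<Rightarrow> 'a set \<Rightarrow> bool" where
  "crosses r e f \<longleftrightarrow> (\<exists>a\<^sub>1 b\<^sub>1 a\<^sub>2 b\<^sub>2. e = {a\<^sub>1, b\<^sub>1} \<and> f = {a\<^sub>2, b\<^sub>2} \<and>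
     (a\<^sub>1, a\<^sub>2) \<in> r \<and> (a\<^sub>2, b\<^sub>1) \<in> r \<and> (b\<^sub>1, b\<^sub>2) \<in> r)"

definition nests :: "'a rel \<Rightarrow> 'a set \<Rightarrow> 'a set \<Rightarrow> bool" where
  "nests r e f \<longleftrightarrow> (\<exists>a\<^sub>1 b\<^sub>1 a\<^sub>2 b\<^sub>2. e = {a\<^sub>1, b\<^sub>1} \<and> f = {a\<^sub>2, b\<^sub>2} \<and>
     (a\<^sub>1, a\<^sub>2) \<in> r \<and> (a\<^sub>2, b\<^sub>2) \<in> r \<and> (b\<^sub>2, b\<^sub>1) \<in> r)"

definition is_stack :: "'a rel \<Rightarrow> 'a set set \<Rightarrow> bool" where
  "is_stack r S \<longleftrightarrow> (\<forall>e\<in>S. \<forall>f\<in>S. \<not> crosses r e f)"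

definition is_queue :: "'a rel \<Rightarrow> 'a set set \<Rightarrow> bool" where
  "is_queue r Q \<longleftrightarrow> (\<forall>e\<in>Q. \<forall>f\<in>Q. \<not> nests r e f)"

definition mixed_layout :: "('a, 'b) pre_digraph \<Rightarrow> nat \<Rightarrow> nat \<Rightarrow> bool" where
  "mixed_layout G s q \<longleftrightarrow>
     (\<exists>r. strict_linear_order_on (verts G) r \<and>
       (\<exists>\<S> \<Q>. finite \<S> \<and> card \<S> = s \<and> (\<forall>S\<in>\<S>. is_stack r S) \<and>
              finite \<Q> \<and> card \<Q> = q \<and> (\<forall>Q\<in>\<Q>. is_queue r Q) \<and>
              \<S> \<inter> \<Q> = {} \<and> partition_on (uedges G) (\<S> \<union> \<Q>)))"

definition mixed_page_number :: "('a, 'b) pre_digraph \<Rightarrow> nat" where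
  "mixed_page_number G = (LEAST k. \<exists>s q. k = s + q \<and> mixed_layout G s q)"

text \<open>The minimum is over a nonempty set, so the \<open>LEAST\<close> above is meaningful.\<close>

lemma mixed_page_number_attained:
  assumes "graph G"
  shows "\<exists>s q. mixed_page_number G = s + q \<and> mixed_layout G s q"
proof -
  interpret graph G by fact
  obtain r where r: "well_order_on (verts G) r"
    using well_order_on by blast
  then have lin: "linear_order_on (verts G) r"
    by (simp add: well_order_on_def)
  have tr: "trans r" and an: "antisym r" and tot: "total_on (verts G) r"
    using lin by (auto simp: linear_order_on_def partial_order_on_def preorder_on_def)
  have strict: "strict_linear_order_on (verts G) (r - Id)"
    unfolding strict_linear_order_on_def
    using trans_diff_Id[OF tr an] tot by (auto simp: irrefl_def total_on_def)
  have fin: "finite (uedges G)"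
  proof -
    have "uedges G = (\<lambda>(u, v). {u, v}) ` arcs_ends G"
      by (auto simp: uedges_def)
    then show ?thesis
      by (simp add: arcs_ends_def)
  qed
  have single: "is_stack (r - Id) {e}" for e
    using tr an by (auto simp: is_stack_def crosses_def doubleton_eq_iff dest: antisymD transD)
  have "mixed_layout G (card ((\<lambda>e. {e}) ` uedges G)) 0"
    unfolding mixed_layout_def
  proof (intro exI conjI)
    show "partition_on (uedges G) ((\<lambda>e. {e}) ` uedges G \<union> {})"
      by (auto simp: partition_on_def disjoint_def)
  qed (use strict fin single in auto)
  then have "\<exists>k s q. k = s + q \<and> mixed_layout G s q"
    by blast
  then show ?thesis
    unfolding mixed_page_number_def by (rule LeastI_ex)
qed

end

theory Submission
  imports Defs
begin

text \<open>
  Number the \<open>N = 2n\<close> vertices along the order and colour them by their part; the \<open>n\<^sup>2\<close> edges are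
  the bichromatic pairs \<open>i < j\<close>. Let \<open>M\<close> be the number of bichromatic sides of the polygon on
  \<open>0, \<dots>, N - 1\<close>.

  A stack is an outerplanar bipartite graph, so it has at most \<open>N - 2 - M/2\<close> edges that are not
  sides; as the sides are counted only once, \<open>s \<ge> 1\<close> stacks cover at most \<open>s (N - 2) + M/2\<close> edges.

  The edges of a queue have distinct sums \<open>i + j\<close>. There are about \<open>2N\<close> sums, but few edges with an
  extreme sum: some prefix has \<open>q\<close> vertices of one colour and \<open>m \<le> q\<close> of the other, and the edges
  with sum below \<open>2q + m\<close> are among the \<open>q m\<close> edges inside this prefix and at most \<open>q (q + 1) / 2\<close>
  others, although \<open>q\<close> queues could use each sum \<open>q\<close> times. Applying this at both ends, \<open>q\<close> queues
  cover at most \<open>2Nq - 3q\<^sup>2 - \<mu>\<close> edges, where \<open>\<mu>\<close> counts the minority vertices among the first and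
  among the last \<open>q\<close> vertices.

  Every bichromatic side inside one of these two groups has an end in its minority colour, so
  \<open>M \<le> N - 2q + 2 + 2\<mu>\<close>. For \<open>s \<ge> 1\<close> this gives \<open>(n - q) (n - 3q) \<le> 2s (n - 1) + n - q + 1\<close>, and for
  \<open>s = 0\<close> the queue bound alone gives \<open>(n - q) (n - 3q) \<le> 0\<close>; both are impossible for
  \<open>n > 3 (s + q)\<close>.
\<close>

section \<open>Two-coloured linear orders\<close>

definition bichromatic :: "('a::linorder \<Rightarrow> 'c) \<Rightarrow> 'a set \<Rightarrow> ('a \<times> 'a) set" where
  "bichromatic c A = {(i, j) \<in> A \<times> A. i < j \<and> c i \<noteq> c j}"

definition noncrossing :: "('a::linorder \<times> 'a) set \<Rightarrow> bool" where
  "noncrossing X \<longleftrightarrow> (\<forall>(i, j)\<in>X. \<forall>(i', j')\<in>X. \<not> (i < i' \<and> i' < j \<and> j < j'))"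

definition nonnesting :: "('a::linorder \<times> 'a) set \<Rightarrow> bool" where
  "nonnesting X \<longleftrightarrow> (\<forall>(i, j)\<in>X. \<forall>(i', j')\<in>X. \<not> (i < i' \<and> i' < j' \<and> j' < j))"

definition colour_count :: "('a \<Rightarrow> bool) \<Rightarrow> bool \<Rightarrow> 'a set \<Rightarrow> nat" where
  "colour_count c b A = card {i \<in> A. c i = b}"

definition minority :: "('a \<Rightarrow> bool) \<Rightarrow> 'a set \<Rightarrow> nat" where
  "minority c A = min (colour_count c True A) (colour_count c False A)"

lemma finite_bichromatic [simp]: "finite A \<Longrightarrow> finite (bichromatic c A)"
  by (rule finite_subset[of _ "A \<times> A"]) (auto simp: bichromatic_def)

lemma noncrossingD:
  "noncrossing X \<Longrightarrow> (i, j) \<in> X \<Longrightarrow> (i', j') \<in> X \<Longrightarrow> \<not> (i < i' \<and> i' < j \<and> j < j')"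
  unfolding noncrossing_def by blast

lemma noncrossing_subset: "noncrossing X \<Longrightarrow> Y \<subseteq> X \<Longrightarrow> noncrossing Y"
  unfolding noncrossing_def by blast

lemma nonnestingD:
  "nonnesting X \<Longrightarrow> (i, j) \<in> X \<Longrightarrow> (i', j') \<in> X \<Longrightarrow> \<not> (i < i' \<and> i' < j' \<and> j' < j)"
  unfolding nonnesting_def by blast

lemma colour_count_empty [simp]: "colour_count c b {} = 0"
  by (simp add: colour_count_def)

lemma colour_count_insert:
  assumes "finite A" "a \<notin> A"
  shows "colour_count c b (insert a A) = colour_count c b A + of_bool (c a = b)"
proof -
  have "{i \<in> insert a A. c i = b} = {i \<in> A. c i = b} \<union> (if c a = b then {a} else {})"
    by auto
  then show ?thesis using assms by (simp add: colour_count_def)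
qed

lemma colour_count_add:
  assumes "finite A"
  shows "colour_count c b A + colour_count c (\<not> b) A = card A"
  using assms by (induction rule: finite_induct) (auto simp: colour_count_insert)

lemma colour_count_le: "finite A \<Longrightarrow> colour_count c b A \<le> card A"
  unfolding colour_count_def by (intro card_mono) auto

lemma colour_count_add_minority_le: "finite A \<Longrightarrow> colour_count c b A + minority c A \<le> card A"
  using colour_count_add[of A c b] by (cases b) (auto simp: minority_def)

lemma card_bichromatic:
  fixes A :: "'a::linorder set"
  shows "card (bichromatic c A) = colour_count c b A * colour_count c (\<not> b) A"
proof -
  let ?orient = "\<lambda>(i, j). if c i then (i, j) else (j, i)"
  have "bij_betw ?orient (bichromatic c A) ({i \<in> A. c i} \<times> {i \<in> A. \<not> c i})"
    by (rule bij_betw_byWitness[where f' = "\<lambda>(i, j). (min i j, max i j)"])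
      (auto simp: bichromatic_def min_def max_def not_le less_le split: if_splits)
  then have "card (bichromatic c A) = colour_count c True A * colour_count c False A"
    by (simp add: bij_betw_same_card colour_count_def card_cartesian_product)
  then show ?thesis by (cases b) simp_all
qed

section \<open>Stacks\<close>

definition changes :: "(nat \<Rightarrow> 'c) \<Rightarrow> nat \<Rightarrow> nat \<Rightarrow> nat" where
  "changes c l r = (\<Sum>i=l..<r. of_bool (c i \<noteq> c (Suc i)))"

lemma changes_split: "l \<le> k \<Longrightarrow> k \<le> r \<Longrightarrow> changes c l r = changes c l k + changes c k r"
  unfolding changes_def by (rule sum.atLeastLessThan_concat[symmetric])

lemma changes_le: "changes c l r \<le> r - l"
  unfolding changes_def by (rule order.trans[OF sum_bounded_above[where K = 1]]) auto

lemma noncrossing_apex: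
  fixes l r :: nat
  assumes X: "X \<subseteq> bichromatic c {l..r}" and nc: "noncrossing X" and lr: "Suc l < r"
  obtains k where "l < k" "k < r" "\<forall>(i, j)\<in>X. i < k \<and> k < j \<longrightarrow> i = l \<and> j = r"
proof -
  define K where "K = insert (Suc l) {k. k < r \<and> (l, k) \<in> X}"
  define k where "k = Max K"
  have K: "finite K" "K \<noteq> {}" by (auto simp: K_def)
  have k: "k = Suc l \<or> k < r \<and> (l, k) \<in> X"
    using Max_in[OF K] by (auto simp: k_def K_def)
  show thesis
  proof (rule that)
    show "l < k" "k < r" using k X lr by (auto simp: bichromatic_def)
    have "i = l \<and> j = r" if ij: "(i, j) \<in> X" "i < k" "k < j" for i j
    proof -
      have bounds: "l \<le> i" "j \<le> r" using ij X by (auto simp: bichromatic_def)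
      have "i = l" using k noncrossingD[OF nc, of l k i j] ij bounds by auto
      moreover have "j \<notin> K" using Max_ge[OF K(1), of j] ij(3) by (auto simp: k_def)
      ultimately show ?thesis using ij bounds by (auto simp: K_def)
    qed
    then show "\<forall>(i, j)\<in>X. i < k \<and> k < j \<longrightarrow> i = l \<and> j = r" by blast
  qed
qed

lemma card_bichromatic_Int_singleton:
  assumes "X \<subseteq> bichromatic c A"
  shows "card (X \<inter> {(i, j)}) \<le> of_bool (c i \<noteq> c j)"
proof (cases "c i = c j")
  case True
  then have "X \<inter> {(i, j)} = {}" using assms by (auto simp: bichromatic_def)
  then show ?thesis by simp
next
  case False
  then show ?thesis using card_mono[of "{(i, j)}" "X \<inter> {(i, j)}"] by simp
qed

lemma card_noncrossing_split:
  fixes l r :: nat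
  assumes X: "X \<subseteq> bichromatic c {l..r}" and nc: "noncrossing X" and lr: "Suc l < r"
  obtains k where "l < k" "k < r"
    "card X \<le> of_bool (c l \<noteq> c r)
      + (card (X \<inter> bichromatic c {l..k}) + card (X \<inter> bichromatic c {k..r}))"
proof -
  obtain k where k: "l < k" "k < r"
    and apex: "\<forall>(i, j)\<in>X. i < k \<and> k < j \<longrightarrow> i = l \<and> j = r"
    by (rule noncrossing_apex[OF assms])
  let ?longest = "X \<inter> {(l, r)}"
  let ?left = "X \<inter> bichromatic c {l..k}" and ?right = "X \<inter> bichromatic c {k..r}"
  have "X = ?longest \<union> (?left \<union> ?right)"
  proof (intro equalityI subrelI)
    fix i j assume ij: "(i, j) \<in> X"
    consider "j \<le> k" | "k \<le> i" | "i < k" "k < j" by linarith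
    then show "(i, j) \<in> ?longest \<union> (?left \<union> ?right)"
      using ij X apex by cases (auto simp: bichromatic_def)
  qed auto
  then have "card X \<le> card ?longest + card (?left \<union> ?right)"
    by (metis card_Un_le)
  also have "\<dots> \<le> of_bool (c l \<noteq> c r) + (card ?left + card ?right)"
    by (rule add_mono[OF card_bichromatic_Int_singleton[OF X] card_Un_le])
  finally show thesis using that k by blast
qed

text \<open>Euler's bound for an outerplanar bipartite graph, sharpened by the number of sides of the
  polygon \<open>l, \<dots>, r\<close> that may be edges at all. The induction step works because only two sides of
  the triangle \<open>l, k, r\<close> can be bichromatic.\<close>

lemma card_noncrossing:
  fixes c :: "nat \<Rightarrow> bool"
  assumes "l < r" and "X \<subseteq> bichromatic c {l..r}" and "noncrossing X"
  shows "2 * card X + 2 \<le> 2 * (r - l) + changes c l r + of_bool (c l \<noteq> c r)"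
  using assms
proof (induction "r - l" arbitrary: l r X rule: less_induct)
  case less
  note X = less.prems(2) and nc = less.prems(3)
  show ?case
  proof (cases "Suc l < r")
    case False
    then have r: "r = Suc l" using less.prems by simp
    then have "X = X \<inter> {(l, r)}" using X by (auto simp: bichromatic_def le_Suc_eq)
    then have "card X \<le> of_bool (c l \<noteq> c r)"
      using card_bichromatic_Int_singleton[OF X] by metis
    then show ?thesis using r by (cases "c l = c r") (simp_all add: changes_def)
  next
    case True
    obtain k where k: "l < k" "k < r" and split: "card X \<le> of_bool (c l \<noteq> c r)
        + (card (X \<inter> bichromatic c {l..k}) + card (X \<inter> bichromatic c {k..r}))"
      by (rule card_noncrossing_split[OF X nc True])
    have "2 * card (X \<inter> bichromatic c {l..k}) + 2
        \<le> 2 * (k - l) + changes c l k + of_bool (c l \<noteq> c k)"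
      by (rule less.hyps) (use k noncrossing_subset[OF nc] in auto)
    moreover have "2 * card (X \<inter> bichromatic c {k..r}) + 2
        \<le> 2 * (r - k) + changes c k r + of_bool (c k \<noteq> c r)"
      by (rule less.hyps) (use k noncrossing_subset[OF nc] in auto)
    moreover have "of_bool (c l \<noteq> c k) + of_bool (c k \<noteq> c r) + of_bool (c l \<noteq> c r) \<le> (2::nat)"
      by auto
    moreover have "changes c l r = changes c l k + changes c k r"
      using k by (intro changes_split) auto
    ultimately show ?thesis using split k by linarith
  qed
qed

definition sides :: "(nat \<Rightarrow> 'c) \<Rightarrow> nat \<Rightarrow> nat \<Rightarrow> (nat \<times> nat) set" where
  "sides c l r = {(i, j) \<in> bichromatic c {l..r}. j = Suc i \<or> (i, j) = (l, r)}"

lemma sides_subset: "sides c l r \<subseteq> bichromatic c {l..r}"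
  by (auto simp: sides_def)

lemma finite_sides [simp]: "finite (sides c l r)"
  by (rule finite_subset[OF sides_subset]) simp

lemma card_sides:
  assumes "Suc l < r"
  shows "card (sides c l r) = changes c l r + of_bool (c l \<noteq> c r)"
proof -
  let ?inner = "(\<lambda>i. (i, Suc i)) ` {i \<in> {l..<r}. c i \<noteq> c (Suc i)}"
  let ?closing = "if c l \<noteq> c r then {(l, r)} else {}"
  have "sides c l r = ?inner \<union> ?closing"
    using assms by (auto simp: sides_def bichromatic_def)
  moreover have "card (?inner \<union> ?closing) = card ?inner + card ?closing"
    using assms by (intro card_Un_disjoint) auto
  moreover have "card ?inner = changes c l r"
    by (subst card_image) (auto simp: inj_on_def changes_def sum.If_cases of_bool_def Int_def)
  ultimately show ?thesis by simp
qed

lemma noncrossing_Un_sides: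
  assumes "X \<subseteq> bichromatic c {l..r}" "noncrossing X"
  shows "noncrossing (X \<union> sides c l r)"
  using assms unfolding noncrossing_def sides_def bichromatic_def by fastforce

lemma card_noncrossing_diff_sides:
  fixes c :: "nat \<Rightarrow> bool"
  assumes "Suc l < r" "X \<subseteq> bichromatic c {l..r}" "noncrossing X"
  shows "2 * card (X - sides c l r) + card (sides c l r) + 2 \<le> 2 * (r - l)"
proof -
  have "finite X" by (rule finite_subset[OF assms(2)]) simp
  then have "card (X \<union> sides c l r) = card (X - sides c l r) + card (sides c l r)"
    by (subst card_Un_disjoint[symmetric]) auto
  moreover have "2 * card (X \<union> sides c l r) + 2 \<le> 2 * (r - l) + card (sides c l r)"
    unfolding card_sides[OF assms(1)] add.assoc[symmetric]
    by (intro card_noncrossing noncrossing_Un_sides) (use assms sides_subset[of c l r] in auto)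
  ultimately show ?thesis by linarith
qed

lemma card_Union_noncrossing:
  fixes c :: "nat \<Rightarrow> bool"
  assumes "Suc l < r" and fin: "finite \<S>" and sub: "\<Union>\<S> \<subseteq> bichromatic c {l..r}"
    and nc: "\<And>X. X \<in> \<S> \<Longrightarrow> noncrossing X"
  shows "2 * card (\<Union>\<S>) + card \<S> * (card (sides c l r) + 2)
    \<le> card \<S> * (2 * (r - l)) + 2 * card (sides c l r)"
proof -
  let ?sides = "sides c l r"
  have "finite (\<Union>\<S>)" by (rule finite_subset[OF sub]) simp
  then have "card (\<Union>\<S>) \<le> card ((\<Union>X\<in>\<S>. X - ?sides) \<union> ?sides)"
    by (intro card_mono) (auto intro: finite_subset[of _ "\<Union>\<S>"])
  also have "\<dots> \<le> card (\<Union>X\<in>\<S>. X - ?sides) + card ?sides" by (rule card_Un_le)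
  also have "\<dots> \<le> (\<Sum>X\<in>\<S>. card (X - ?sides)) + card ?sides"
    by (intro add_right_mono card_UN_le fin)
  finally have "2 * card (\<Union>\<S>) + card \<S> * (card ?sides + 2)
      \<le> (\<Sum>X\<in>\<S>. 2 * card (X - ?sides) + card ?sides + 2) + 2 * card ?sides"
    by (simp add: sum.distrib algebra_simps del: add_2_eq_Suc add_2_eq_Suc' flip: sum_distrib_left)
  also have "(\<Sum>X\<in>\<S>. 2 * card (X - ?sides) + card ?sides + 2) \<le> (\<Sum>X\<in>\<S>. 2 * (r - l))"
    by (intro sum_mono card_noncrossing_diff_sides) (use assms in auto)
  finally show ?thesis by simp
qed

section \<open>Queues\<close>

lemma inj_on_sum_nonnesting:
  fixes X :: "(nat \<times> nat) set"
  assumes "X \<subseteq> bichromatic c A" "nonnesting X"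
  shows "inj_on (\<lambda>(i, j). i + j) X"
proof (rule inj_onI, clarify)
  fix i j i' j' assume edges: "(i, j) \<in> X" "(i', j') \<in> X" and sums: "i + j = i' + j'"
  then have "i < j" "i' < j'" using assms(1) by (auto simp: bichromatic_def)
  then show "i = i' \<and> j = j'"
    using nonnestingD[OF assms(2) edges] nonnestingD[OF assms(2) edges(2,1)] sums by linarith
qed

lemma card_Union_nonnesting_sum_between:
  fixes \<Q> :: "(nat \<times> nat) set set"
  assumes fin: "finite \<Q>" and sub: "\<Union>\<Q> \<subseteq> bichromatic c A"
    and nn: "\<And>X. X \<in> \<Q> \<Longrightarrow> nonnesting X"
  shows "card {(i, j) \<in> \<Union>\<Q>. a \<le> i + j \<and> i + j < b} \<le> card \<Q> * (b - a)"
proof -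
  let ?between = "\<lambda>X. {(i, j) \<in> X. a \<le> i + j \<and> i + j < b}"
  have single: "card (?between X) \<le> b - a" if X: "X \<in> \<Q>" for X
  proof -
    have "X \<subseteq> bichromatic c A" using sub X by blast
    then have "inj_on (\<lambda>(i, j). i + j) (?between X)"
      by (rule inj_on_subset[OF inj_on_sum_nonnesting[OF _ nn[OF X]]]) auto
    then have "card (?between X) \<le> card {a..<b}"
      by (rule card_inj_on_le) auto
    then show ?thesis by simp
  qed
  have "?between (\<Union>\<Q>) = (\<Union>X\<in>\<Q>. ?between X)" by auto
  then have "card (?between (\<Union>\<Q>)) \<le> (\<Sum>X\<in>\<Q>. card (?between X))"
    using card_UN_le[OF fin] by simp
  also have "\<dots> \<le> (\<Sum>X\<in>\<Q>. b - a)" by (rule sum_mono) (rule single)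
  finally show ?thesis by simp
qed

definition low_sum :: "(nat \<Rightarrow> 'c) \<Rightarrow> nat \<Rightarrow> (nat \<times> nat) set" where
  "low_sum c t = {(i, j) \<in> bichromatic c {..<t}. i + j < t}"

lemma finite_low_sum [simp]: "finite (low_sum c t)"
  by (rule finite_subset[of _ "bichromatic c {..<t}"]) (auto simp: low_sum_def)

lemma card_low_sum_le:
  "card (low_sum c (u + q))
    \<le> card (bichromatic c {..<u}) + (\<Sum>d<q. colour_count c (\<not> c (u + d)) {..<q - d})"
proof -
  let ?row = "\<lambda>d. (\<lambda>i. (i, u + d)) ` {i \<in> {..<q - d}. c i = (\<not> c (u + d))}"
  have "low_sum c (u + q) \<subseteq> bichromatic c {..<u} \<union> (\<Union>d<q. ?row d)"
  proof (rule subrelI)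
    fix i j assume ij: "(i, j) \<in> low_sum c (u + q)"
    show "(i, j) \<in> bichromatic c {..<u} \<union> (\<Union>d<q. ?row d)"
    proof (cases "j < u")
      case True
      then show ?thesis using ij by (auto simp: low_sum_def bichromatic_def)
    next
      case False
      then obtain d where d: "j = u + d" using le_Suc_ex not_less by blast
      then have "d < q" "(i, j) \<in> ?row d" using ij by (auto simp: low_sum_def bichromatic_def)
      then show ?thesis by blast
    qed
  qed
  then have "card (low_sum c (u + q)) \<le> card (bichromatic c {..<u} \<union> (\<Union>d<q. ?row d))"
    by (rule card_mono[rotated]) simp
  also have "\<dots> \<le> card (bichromatic c {..<u}) + card (\<Union>d<q. ?row d)"
    by (rule card_Un_le)
  also have "card (\<Union>d<q. ?row d) \<le> (\<Sum>d<q. card (?row d))"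
    by (rule card_UN_le) simp
  also have "(\<Sum>d<q. card (?row d)) = (\<Sum>d<q. colour_count c (\<not> c (u + d)) {..<q - d})"
    by (intro sum.cong refl) (simp add: colour_count_def card_image inj_on_def)
  finally show ?thesis by simp
qed

lemma sum_colour_count_le:
  "2 * (\<Sum>d<q. colour_count c (b d) {..<q - d}) + 2 * minority c {..<q} \<le> q * (q + 1)"
proof (cases q)
  case (Suc p)
  have "(\<Sum>d<q. colour_count c (b d) {..<q - d})
      = colour_count c (b 0) {..<q} + (\<Sum>d<p. colour_count c (b (Suc d)) {..<p - d})"
    using Suc by (simp add: sum.lessThan_Suc_shift del: sum.lessThan_Suc)
  also have "(\<Sum>d<p. colour_count c (b (Suc d)) {..<p - d}) \<le> (\<Sum>d<p. p - d)"
    by (rule sum_mono) (metis card_lessThan colour_count_le finite_lessThan)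
  finally have "2 * (\<Sum>d<q. colour_count c (b d) {..<q - d}) + 2 * minority c {..<q}
      \<le> 2 * q + 2 * (\<Sum>d<p. p - d)"
    using colour_count_add_minority_le[of "{..<q}" c "b 0"] by simp
  also have "2 * (\<Sum>d<p. p - d) = p * (p + 1)"
    by (induction p) (simp_all add: sum.lessThan_Suc_shift del: sum.lessThan_Suc)
  finally show ?thesis using Suc by simp
qed (simp add: minority_def)

lemma exists_prefix_colour_counts:
  obtains m b where "m \<le> q"
    "colour_count c b {..<q + m} = q" "colour_count c (\<not> b) {..<q + m} = m"
proof -
  define f where "f u = max (colour_count c True {..<u}) (colour_count c False {..<u})" for u
  have count: "colour_count c True {..<u} + colour_count c False {..<u} = u" for u
    using colour_count_add[of "{..<u}" c True] by simp
  have "\<exists>u\<le>2 * q. int (f u) = int q"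
  proof (rule nat0_intermed_int_val)
    show "\<forall>u<2 * q. \<bar>int (f (u + 1)) - int (f u)\<bar> \<le> 1"
      by (auto simp: f_def lessThan_Suc colour_count_insert)
    show "int q \<le> int (f (2 * q))" using count[of "2 * q"] by (auto simp: f_def)
  qed (simp add: f_def)
  then obtain u where u: "f u = q" by auto
  then obtain b where b: "colour_count c b {..<u} = q" "colour_count c (\<not> b) {..<u} \<le> q"
    unfolding f_def by (metis max.cobounded1 max.cobounded2 max_def)
  moreover have "u = q + colour_count c (\<not> b) {..<u}"
    using colour_count_add[of "{..<u}" c b] b(1) by simp
  ultimately show thesis using that by metis
qed

text \<open>Using each of the \<open>t\<close> lowest sums \<open>q\<close> times would give \<open>q * t\<close> edges.\<close>

lemma exists_low_sum_threshold:
  obtains t where "t \<le> 3 * q"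
    "2 * card (low_sum c t) + 2 * minority c {..<q} + 3 * q\<^sup>2 \<le> 2 * (q * t) + q"
proof -
  obtain m b where m: "m \<le> q" and
    counts: "colour_count c b {..<q + m} = q" "colour_count c (\<not> b) {..<q + m} = m"
    by (rule exists_prefix_colour_counts)
  let ?t = "q + m + q"
  have "card (low_sum c ?t) \<le> q * m + (\<Sum>d<q. colour_count c (\<not> c (q + m + d)) {..<q - d})"
    using card_low_sum_le[of c "q + m" q] card_bichromatic[of c "{..<q + m}" b] counts by simp
  moreover have "2 * (\<Sum>d<q. colour_count c (\<not> c (q + m + d)) {..<q - d}) + 2 * minority c {..<q}
      \<le> q * (q + 1)"
    by (rule sum_colour_count_le)
  moreover have "2 * (q * m) + q * (q + 1) + 3 * q\<^sup>2 = 2 * (q * ?t) + q"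
    by (simp add: algebra_simps power2_eq_square)
  ultimately have "2 * card (low_sum c ?t) + 2 * minority c {..<q} + 3 * q\<^sup>2 \<le> 2 * (q * ?t) + q"
    by linarith
  then show thesis using that[of ?t] m by simp
qed

lemma card_high_sum_le:
  "card {(i, j) \<in> bichromatic c {..<N}. 2 * N \<le> i + j + t + 1}
    \<le> card (low_sum (\<lambda>i. c (N - Suc i)) t)"
proof (rule card_inj_on_le)
  let ?reflect = "\<lambda>(i, j). (N - Suc j, N - Suc i)"
  let ?high = "{(i, j) \<in> bichromatic c {..<N}. 2 * N \<le> i + j + t + 1}"
  show "inj_on ?reflect ?high"
    by (auto simp: inj_on_def bichromatic_def)
  show "?reflect ` ?high \<subseteq> low_sum (\<lambda>i. c (N - Suc i)) t"
    by (auto simp: bichromatic_def low_sum_def)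
qed simp

lemma minority_reflect:
  assumes "q \<le> N"
  shows "minority (\<lambda>i. c (N - Suc i)) {..<q} = minority c {N - q..<N}"
proof -
  have "bij_betw (\<lambda>i. N - Suc i) {i \<in> {..<q}. c (N - Suc i) = b} {i \<in> {N - q..<N}. c i = b}" for b
    by (rule bij_betw_byWitness[where f' = "\<lambda>i. N - Suc i"]) (use assms in auto)
  from this[THEN bij_betw_same_card] show ?thesis
    by (simp only: minority_def colour_count_def)
qed

lemma card_Union_nonnesting:
  assumes fin: "finite \<Q>" and q: "card \<Q> = q" and N: "3 * q < N"
    and sub: "\<Union>\<Q> \<subseteq> bichromatic c {..<N}" and nn: "\<And>X. X \<in> \<Q> \<Longrightarrow> nonnesting X"
  shows "card (\<Union>\<Q>) + 3 * q\<^sup>2 + minority c {..<q} + minority c {N - q..<N} \<le> 2 * N * q"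
proof -
  let ?c' = "\<lambda>i. c (N - Suc i)"
  obtain t where t: "t \<le> 3 * q"
    "2 * card (low_sum c t) + 2 * minority c {..<q} + 3 * q\<^sup>2 \<le> 2 * (q * t) + q"
    by (rule exists_low_sum_threshold)
  obtain t' where t': "t' \<le> 3 * q"
    "2 * card (low_sum ?c' t') + 2 * minority ?c' {..<q} + 3 * q\<^sup>2 \<le> 2 * (q * t') + q"
    by (rule exists_low_sum_threshold)
  have "t + t' + 1 \<le> 2 * N" using t(1) t'(1) N by linarith
  then obtain d where d: "2 * N = t + t' + 1 + d" using le_Suc_ex by blast
  let ?mid = "{(i, j) \<in> \<Union>\<Q>. t \<le> i + j \<and> i + j < t + d}"
  let ?high = "{(i, j) \<in> bichromatic c {..<N}. 2 * N \<le> i + j + t' + 1}"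
  have "\<Union>\<Q> \<subseteq> low_sum c t \<union> (?mid \<union> ?high)"
    using sub d by (auto simp: low_sum_def bichromatic_def)
  moreover have "finite (\<Union>\<Q>)" by (rule finite_subset[OF sub]) simp
  then have "finite ?mid" by (rule rev_finite_subset) auto
  moreover have "finite ?high"
    by (rule finite_subset[of _ "bichromatic c {..<N}"]) auto
  ultimately have "card (\<Union>\<Q>) \<le> card (low_sum c t \<union> (?mid \<union> ?high))"
    by (intro card_mono) auto
  also have "\<dots> \<le> card (low_sum c t) + (card ?mid + card ?high)"
    by (intro order.trans[OF card_Un_le] add_left_mono card_Un_le)
  also have "card ?mid \<le> q * d"
    using card_Union_nonnesting_sum_between[OF fin sub nn, of t "t + d"] q by simp
  also have "card ?high \<le> card (low_sum ?c' t')" by (rule card_high_sum_le)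
  finally have "2 * card (\<Union>\<Q>) + 2 * minority c {..<q} + 2 * minority ?c' {..<q} + 6 * q\<^sup>2
      \<le> 2 * (q * t) + 2 * (q * t') + 2 * q + 2 * (q * d)"
    using t(2) t'(2) by linarith
  also have "\<dots> = 2 * (2 * N * q)"
    unfolding d by (simp add: algebra_simps)
  finally show ?thesis using N minority_reflect[of q N c] by simp
qed

section \<open>Covering all bichromatic pairs\<close>

lemma changes_le_minority:
  assumes "l \<le> r"
  shows "changes c l r \<le> 2 * minority c {l..r}"
proof -
  have "changes c l r + of_bool (c r = b) \<le> 2 * colour_count c b {l..r}" for b
    using assms
    by (induction rule: dec_induct)
      (auto simp: changes_def atLeastAtMostSuc_conv colour_count_insert)
  from this[of True] this[of False] show ?thesis by (simp add: minority_def)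
qed

lemma card_sides_le_minority:
  assumes "2 * q \<le> N" "2 < N"
  shows "card (sides c 0 (N - 1)) + 2 * q
    \<le> N + 2 + 2 * minority c {..<q} + 2 * minority c {N - q..<N}"
proof -
  have "changes c 0 (N - 1) + 2 * q \<le> N + 1 + 2 * minority c {..<q} + 2 * minority c {N - q..<N}"
  proof (cases q)
    case 0
    then show ?thesis using changes_le[of c 0 "N - 1"] by simp
  next
    case (Suc p)
    have "changes c 0 (N - 1) = changes c 0 p + changes c p (N - q) + changes c (N - q) (N - 1)"
      using assms Suc changes_split[of 0 p "N - 1" c] changes_split[of p "N - q" "N - 1" c] by simp
    moreover have "{0..p} = {..<q}" "{N - q..N - 1} = {N - q..<N}" using assms Suc by auto
    then have "changes c 0 p \<le> 2 * minority c {..<q}"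
      "changes c (N - q) (N - 1) \<le> 2 * minority c {N - q..<N}"
      using changes_le_minority[of 0 p c] changes_le_minority[of "N - q" "N - 1" c] Suc by simp_all
    moreover have "changes c p (N - q) \<le> N - q - p" by (rule changes_le)
    ultimately show ?thesis using Suc assms by linarith
  qed
  moreover have "card (sides c 0 (N - 1)) = changes c 0 (N - 1) + of_bool (c 0 \<noteq> c (N - 1))"
    using assms by (intro card_sides) simp
  ultimately show ?thesis by simp
qed

lemma card_Union_noncrossing_le_minority:
  assumes fin: "finite \<S>" and ne: "\<S> \<noteq> {}" and q: "2 * q \<le> N" and N: "2 < N"
    and sub: "\<Union>\<S> \<subseteq> bichromatic c {..<N}" and nc: "\<And>X. X \<in> \<S> \<Longrightarrow> noncrossing X"
  shows "2 * card (\<Union>\<S>) + 4 * card \<S> + 2 * q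
    \<le> 2 * N * card \<S> + N + 2 + 2 * (minority c {..<q} + minority c {N - q..<N})"
proof -
  let ?M = "card (sides c 0 (N - 1))"
  have interval: "{0..N - 1} = {..<N}" using N by auto
  have "2 * card (\<Union>\<S>) + card \<S> * (?M + 2) \<le> card \<S> * (2 * (N - 1)) + 2 * ?M"
    using card_Union_noncrossing[OF _ fin _ nc, of 0 "N - 1" c] sub N interval by simp
  then have "2 * card (\<Union>\<S>) + card \<S> * ?M + 4 * card \<S> \<le> 2 * N * card \<S> + 2 * ?M"
    using N by (cases N) (simp_all add: algebra_simps)
  moreover have "?M \<le> card \<S> * ?M"
    using fin ne by (simp add: Suc_le_eq card_gt_0_iff)
  ultimately have "2 * card (\<Union>\<S>) + 4 * card \<S> \<le> 2 * N * card \<S> + ?M"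
    by linarith
  then show ?thesis
    using card_sides_le_minority[OF q N, of c] by simp
qed

lemma le_card_bichromatic_cover:
  assumes balanced: "colour_count c True {..<2 * n} = n"
    and fin: "finite \<S>" "finite \<Q>"
    and nc: "\<And>X. X \<in> \<S> \<Longrightarrow> noncrossing X"
    and nn: "\<And>X. X \<in> \<Q> \<Longrightarrow> nonnesting X"
    and cover: "\<Union>\<S> \<union> \<Union>\<Q> = bichromatic c {..<2 * n}"
  shows "n \<le> 3 * (card \<S> + card \<Q>)"
proof (rule ccontr)
  define s q where "s = card \<S>" and "q = card \<Q>"
  define \<mu> where "\<mu> = minority c {..<q} + minority c {2 * n - q..<2 * n}"
  assume "\<not> ?thesis"
  then have large: "3 * (s + q) + 1 \<le> n" by (simp add: s_def q_def)
  have "n * n = card (bichromatic c {..<2 * n})"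
    using card_bichromatic[of c "{..<2 * n}" True] colour_count_add[of "{..<2 * n}" c True]
      balanced by simp
  also have "\<dots> \<le> card (\<Union>\<S>) + card (\<Union>\<Q>)"
    unfolding cover[symmetric] by (rule card_Un_le)
  finally have total: "n * n \<le> card (\<Union>\<S>) + card (\<Union>\<Q>)" .
  have "card (\<Union>\<Q>) + 3 * q\<^sup>2 + minority c {..<q} + minority c {2 * n - q..<2 * n} \<le> 2 * (2 * n) * q"
    using large cover by (intro card_Union_nonnesting fin nn) (auto simp: q_def)
  then have queues: "card (\<Union>\<Q>) + 3 * q\<^sup>2 + \<mu> \<le> 4 * (n * q)"
    by (simp add: \<mu>_def)
  obtain d where d: "n = 3 * q + d" "3 * s + 1 \<le> d"
    using large le_Suc_ex[of "3 * q" n] by auto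
  have "n * n + 3 * q\<^sup>2 = 4 * (n * q) + (2 * q + d) * d"
    unfolding d(1) by (simp add: algebra_simps power2_eq_square)
  then have uncovered: "(2 * q + d) * d + \<mu> \<le> card (\<Union>\<S>)"
    using total queues by linarith
  have product: "(2 * q + d) * (3 * s + 1) \<le> (2 * q + d) * d"
    using d(2) by (rule mult_left_mono) simp
  show False
  proof (cases "\<S> = {}")
    case True
    then show False using uncovered d by simp
  next
    case False
    then have "s \<noteq> 0" using fin by (simp add: s_def)
    then have "2 * card (\<Union>\<S>) + 4 * s + 2 * q \<le> 2 * (2 * n) * s + 2 * n + 2 + 2 * \<mu>"
      unfolding s_def \<mu>_def using large cover
      by (intro card_Union_noncrossing_le_minority fin False nc) (auto simp: s_def)
    then have "2 * ((2 * q + d) * (3 * s + 1)) + 4 * s + 2 * q \<le> 4 * (n * s) + 2 * n + 2"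
      using uncovered product by linarith
    then have "2 * (s * d) + 4 * s \<le> 2"
      unfolding d(1) by (simp add: algebra_simps)
    then show False using \<open>s \<noteq> 0\<close> by simp
  qed
qed

section \<open>From vertex orders to positions\<close>

definition rank_on :: "'a set \<Rightarrow> 'a rel \<Rightarrow> 'a \<Rightarrow> nat" where
  "rank_on V r x = card {z \<in> V. (z, x) \<in> r}"

lemma rank_on_less_iff:
  assumes fin: "finite V" and lin: "strict_linear_order_on V r" and xy: "x \<in> V" "y \<in> V"
  shows "rank_on V r x < rank_on V r y \<longleftrightarrow> (x, y) \<in> r"
proof -
  have tr: "trans r" and ir: "irrefl r" and tot: "total_on V r"
    using lin by (auto simp: strict_linear_order_on_def)
  have mono: "rank_on V r x < rank_on V r y" if "x \<in> V" "(x, y) \<in> r" for x y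
    unfolding rank_on_def
  proof (rule psubset_card_mono)
    have "x \<notin> {z \<in> V. (z, x) \<in> r}" using ir by (auto simp: irrefl_def)
    then show "{z \<in> V. (z, x) \<in> r} \<subset> {z \<in> V. (z, y) \<in> r}"
      using that by (auto dest: transD[OF tr])
  qed (use fin in simp)
  show ?thesis
    using xy mono tot by (metis less_asym less_irrefl total_on_def)
qed

lemma bij_betw_rank_on:
  assumes fin: "finite V" and lin: "strict_linear_order_on V r"
  shows "bij_betw (rank_on V r) V {..<card V}"
proof -
  have ir: "irrefl r" and tot: "total_on V r"
    using lin by (auto simp: strict_linear_order_on_def)
  have inj: "inj_on (rank_on V r) V"
    using tot rank_on_less_iff[OF assms] by (intro inj_onI) (metis less_irrefl total_on_def)
  have "rank_on V r ` V \<subseteq> {..<card V}"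
  proof (rule image_subsetI)
    fix x assume "x \<in> V"
    then have "{z \<in> V. (z, x) \<in> r} \<subset> V" using ir by (auto simp: irrefl_def)
    then show "rank_on V r x \<in> {..<card V}" using fin by (simp add: rank_on_def psubset_card_mono)
  qed
  then have "rank_on V r ` V = {..<card V}"
    by (rule card_subset_eq[rotated]) (simp_all add: card_image[OF inj])
  with inj show ?thesis by (simp add: bij_betw_def)
qed

definition rank_edges :: "'a set \<Rightarrow> 'a rel \<Rightarrow> 'a set set \<Rightarrow> (nat \<times> nat) set" where
  "rank_edges V r E =
    {(rank_on V r x, rank_on V r y) |x y. x \<in> V \<and> y \<in> V \<and> {x, y} \<in> E \<and> (x, y) \<in> r}"

lemma rank_edges_Un: "rank_edges V r (E \<union> F) = rank_edges V r E \<union> rank_edges V r F"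
  unfolding rank_edges_def by blast

lemma rank_edges_Union: "rank_edges V r (\<Union>\<P>) = \<Union>(rank_edges V r ` \<P>)"
  unfolding rank_edges_def by blast

lemma noncrossing_rank_edges:
  assumes "finite V" "strict_linear_order_on V r" and page: "is_stack r S"
  shows "noncrossing (rank_edges V r S)"
proof -
  have "\<not> ((x, x') \<in> r \<and> (x', y) \<in> r \<and> (y, y') \<in> r)"
    if "{x, y} \<in> S" "{x', y'} \<in> S" for x y x' y'
    using page that unfolding is_stack_def crosses_def by blast
  then show ?thesis
    unfolding noncrossing_def rank_edges_def
    by (auto simp: rank_on_less_iff[OF assms(1,2)])
qed

lemma nonnesting_rank_edges:
  assumes "finite V" "strict_linear_order_on V r" and page: "is_queue r Q"
  shows "nonnesting (rank_edges V r Q)"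
proof -
  have "\<not> ((x, x') \<in> r \<and> (x', y') \<in> r \<and> (y', y) \<in> r)"
    if "{x, y} \<in> Q" "{x', y'} \<in> Q" for x y x' y'
    using page that unfolding is_queue_def nests_def by blast
  then show ?thesis
    unfolding nonnesting_def rank_edges_def
    by (auto simp: rank_on_less_iff[OF assms(1,2)])
qed

lemma mixed_layout_rank_edges:
  assumes fin: "finite (verts G)" and "mixed_layout G s q"
  obtains r \<S> \<Q> where "strict_linear_order_on (verts G) r"
    "finite \<S>" "card \<S> \<le> s" "\<forall>X\<in>\<S>. noncrossing X"
    "finite \<Q>" "card \<Q> \<le> q" "\<forall>X\<in>\<Q>. nonnesting X"
    "\<Union>\<S> \<union> \<Union>\<Q> = rank_edges (verts G) r (uedges G)"
proof -
  obtain r \<S> \<Q> where lin: "strict_linear_order_on (verts G) r"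
    and stacks: "finite \<S>" "card \<S> = s" "\<forall>S\<in>\<S>. is_stack r S"
    and queues: "finite \<Q>" "card \<Q> = q" "\<forall>Q\<in>\<Q>. is_queue r Q"
    and part: "partition_on (uedges G) (\<S> \<union> \<Q>)"
    using assms(2) unfolding mixed_layout_def by blast
  let ?E = "rank_edges (verts G) r"
  have "uedges G = \<Union>\<S> \<union> \<Union>\<Q>"
    using partition_onD1[OF part] by blast
  then have "\<Union>(?E ` \<S>) \<union> \<Union>(?E ` \<Q>) = ?E (uedges G)"
    by (simp only: rank_edges_Un rank_edges_Union)
  moreover have "\<forall>X\<in>?E ` \<S>. noncrossing X" "\<forall>X\<in>?E ` \<Q>. nonnesting X"
    using stacks(3) queues(3) noncrossing_rank_edges[OF fin lin] nonnesting_rank_edges[OF fin lin]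
    by blast+
  moreover have "card (?E ` \<S>) \<le> s" "card (?E ` \<Q>) \<le> q"
    using stacks(1,2) queues(1,2) card_image_le by blast+
  ultimately show thesis
    using that[OF lin, of "?E ` \<S>" "?E ` \<Q>"] stacks(1) queues(1) by simp
qed

lemma rank_edges_complete_bipartite:
  assumes fin: "finite (verts G)" and lin: "strict_linear_order_on (verts G) r"
    and V: "verts G = U \<union> W" and disj: "U \<inter> W = {}" and arcs: "arcs_ends G = U \<times> W \<union> W \<times> U"
  shows "rank_edges (verts G) r (uedges G)
    = bichromatic (\<lambda>i. i \<in> rank_on (verts G) r ` U) {..<card (verts G)}"
proof -
  let ?\<rho> = "rank_on (verts G) r"
  note bij = bij_betw_rank_on[OF fin lin]
  have colour: "?\<rho> x \<in> ?\<rho> ` U \<longleftrightarrow> x \<in> U" if "x \<in> verts G" for x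
    using inj_on_image_mem_iff[OF bij_betw_imp_inj_on[OF bij] that, of U] V by blast
  have edge: "{x, y} \<in> uedges G \<longleftrightarrow> (x \<in> U) \<noteq> (y \<in> U)" if "x \<in> verts G" "y \<in> verts G" for x y
    using that V disj arcs by (auto simp: uedges_def doubleton_eq_iff)
  show ?thesis
  proof (intro equalityI subrelI)
    fix i j assume "(i, j) \<in> rank_edges (verts G) r (uedges G)"
    then obtain x y where xy: "i = ?\<rho> x" "j = ?\<rho> y" "x \<in> verts G" "y \<in> verts G"
      "{x, y} \<in> uedges G" "(x, y) \<in> r"
      by (auto simp: rank_edges_def)
    then have "?\<rho> x < ?\<rho> y" "(?\<rho> x \<in> ?\<rho> ` U) \<noteq> (?\<rho> y \<in> ?\<rho> ` U)"
      using rank_on_less_iff[OF fin lin] colour edge by blast+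
    then show "(i, j) \<in> bichromatic (\<lambda>i. i \<in> ?\<rho> ` U) {..<card (verts G)}"
      using xy bij_betwE[OF bij] by (simp add: bichromatic_def)
  next
    fix i j assume ij: "(i, j) \<in> bichromatic (\<lambda>i. i \<in> ?\<rho> ` U) {..<card (verts G)}"
    then have "i \<in> ?\<rho> ` verts G" "j \<in> ?\<rho> ` verts G"
      unfolding bij_betw_imp_surj_on[OF bij] by (auto simp: bichromatic_def)
    then obtain x y where xy: "i = ?\<rho> x" "j = ?\<rho> y" "x \<in> verts G" "y \<in> verts G" by blast
    then have "(x, y) \<in> r" "{x, y} \<in> uedges G"
      using ij rank_on_less_iff[OF fin lin] colour edge by (simp_all add: bichromatic_def)
    then show "(i, j) \<in> rank_edges (verts G) r (uedges G)"
      using xy by (auto simp: rank_edges_def)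
  qed
qed

lemma mixed_layout_complete_bipartite:
  assumes K: "complete_bipartite_digraph n n G" and layout: "mixed_layout G s q"
  shows "n \<le> 3 * (s + q)"
proof -
  interpret graph G using K by (simp add: complete_bipartite_digraph_def)
  obtain U W where parts: "verts G = U \<union> W" "U \<inter> W = {}" "card U = n" "card W = n"
    and arcs: "arcs_ends G = U \<times> W \<union> W \<times> U"
    using K by (auto simp: complete_bipartite_digraph_def)
  have order: "card (verts G) = 2 * n"
    using parts finite_verts by (simp add: card_Un_disjoint)
  obtain r \<S> \<Q> where lin: "strict_linear_order_on (verts G) r"
    and stacks: "finite \<S>" "card \<S> \<le> s" "\<forall>X\<in>\<S>. noncrossing X"
    and queues: "finite \<Q>" "card \<Q> \<le> q" "\<forall>X\<in>\<Q>. nonnesting X"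
    and cover: "\<Union>\<S> \<union> \<Union>\<Q> = rank_edges (verts G) r (uedges G)"
    by (rule mixed_layout_rank_edges[OF finite_verts layout])
  let ?\<rho> = "rank_on (verts G) r"
  have bij: "bij_betw ?\<rho> (verts G) {..<2 * n}"
    using bij_betw_rank_on[OF finite_verts lin] order by simp
  have "n \<le> 3 * (card \<S> + card \<Q>)"
  proof (rule le_card_bichromatic_cover)
    show "\<Union>\<S> \<union> \<Union>\<Q> = bichromatic (\<lambda>i. i \<in> ?\<rho> ` U) {..<2 * n}"
      using cover rank_edges_complete_bipartite[OF finite_verts lin parts(1,2) arcs] order by simp
    have "{i \<in> {..<2 * n}. (i \<in> ?\<rho> ` U) = True} = ?\<rho> ` U"
      using bij_betw_imp_surj_on[OF bij] parts(1) by auto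
    moreover have "inj_on ?\<rho> U"
      using bij_betw_imp_inj_on[OF bij] parts(1) by (auto intro: inj_on_subset)
    ultimately show "colour_count (\<lambda>i. i \<in> ?\<rho> ` U) True {..<2 * n} = n"
      using parts(3) by (simp add: colour_count_def card_image)
  qed (use stacks queues in auto)
  then show ?thesis using stacks(2) queues(2) by simp
qed

theorem theorem5:
  fixes n :: nat and G :: "('a, 'b) pre_digraph"
  assumes "n \<ge> 1"
    and "complete_bipartite_digraph n n G"
  shows "int (mixed_page_number G) \<ge> \<lceil>real n / 3\<rceil>"
proof -
  have "graph G" using assms(2) by (simp add: complete_bipartite_digraph_def)
  then obtain s q where "mixed_page_number G = s + q" "mixed_layout G s q"
    using mixed_page_number_attained by blast
  then have "n \<le> 3 * mixed_page_number G"
    using mixed_layout_complete_bipartite[OF assms(2)] by simp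
  then have "real n / 3 \<le> of_int (int (mixed_page_number G))" by simp
  then show ?thesis by (simp only: ceiling_le_iff)
qed

end
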